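(* Let $\mathcal{C}$ be a binary minimal code with parameters $[n,k,d]$, where $n = 3(k-1)$. Then $\mathcal{C}$ is equivalent to a code that has a generator matrix of the form $$G = \begin{pmatrix} I_k & P \end{pmatrix},$$ where $I_k$ is the $k \times k$ identity matrix and $P$ is a $k \times (2k-3)$ matrix over $\mathbb{F}_2$, such that each row of $G$ is a codeword of Hamming weight $k$ and each column of $P$ has even Hamming weight. Furthermore $d = k$.
   Context: A binary code with parameters $[n,k,d]$ is a linear subspace of $\mathbb{F}_2^n$ of dimension $k$ whose minimal distance, i.e. the smallest Hamming weight of a nonzero codeword, is $d$. The support of $x \in \mathbb{F}_2^n$ is $\sigma(x) = \{i \mid x_i \neq 0\}$ and its Hamming weight is $|\sigma(x)|$. A nonzero codeword $c \in \mathcal{C}$ is minimal if there is no nonzero codeword $c' \in \mathcal{C}$ with $\sigma(c') \subsetneq \sigma(c)$; a code is minimal if all of its nonzero codewords are minimal. Two codes in $\mathbb{F}_2^n$ are equivalent if there is a linear map from $\mathbb{F}_2^n$ to itself that preserves the Hamming weight and maps one code to the other. A generator matrix of a code of dimension $k$ and length $n$ is a $k \times n$ matrix of rank $k$ whose row span is the code. *)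

theory Defs
  imports "HOL-Library.Z2" "Jordan_Normal_Form.DL_Rank"
begin

abbreviation F2_space :: "nat \<Rightarrow> (bit, bit vec) module" where
  "F2_space n \<equiv> module_vec TYPE(bit) n"

definition support :: "bit vec \<Rightarrow> nat set" where
  "support x = {i. i < dim_vec x \<and> x $ i \<noteq> 0}"

definition hamming_weight :: "bit vec \<Rightarrow> nat" where
  "hamming_weight x = card (support x)"

(* A relation rather than a function of C: the zero code has no minimal distance. *)
definition has_min_distance :: "nat \<Rightarrow> bit vec set \<Rightarrow> nat \<Rightarrow> bool" where
  "has_min_distance n C d \<longleftrightarrow>
     (\<exists>c\<in>C. c \<noteq> 0\<^sub>v n \<and> hamming_weight c = d) \<and>
     (\<forall>c\<in>C. c \<noteq> 0\<^sub>v n \<longrightarrow> d \<le> hamming_weight c)"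

definition binary_code :: "nat \<Rightarrow> nat \<Rightarrow> nat \<Rightarrow> bit vec set \<Rightarrow> bool" where
  "binary_code n k d C \<longleftrightarrow>
     subspace class_ring C (F2_space n) \<and>
     vectorspace.dim class_ring ((F2_space n)\<lparr>carrier := C\<rparr>) = k \<and>
     has_min_distance n C d"

definition minimal_codeword :: "nat \<Rightarrow> bit vec set \<Rightarrow> bit vec \<Rightarrow> bool" where
  "minimal_codeword n C c \<longleftrightarrow>
     c \<in> C \<and> c \<noteq> 0\<^sub>v n \<and>
     \<not> (\<exists>c'\<in>C. c' \<noteq> 0\<^sub>v n \<and> support c' \<subset> support c)"

definition minimal_code :: "nat \<Rightarrow> bit vec set \<Rightarrow> bool" where
  "minimal_code n C \<longleftrightarrow> (\<forall>c\<in>C. c \<noteq> 0\<^sub>v n \<longrightarrow> minimal_codeword n C c)"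

definition equivalent_codes :: "nat \<Rightarrow> bit vec set \<Rightarrow> bit vec set \<Rightarrow> bool" where
  "equivalent_codes n C C' \<longleftrightarrow>
     (\<exists>T. linear_map class_ring (F2_space n) (F2_space n) T \<and>
          (\<forall>x\<in>carrier_vec n. hamming_weight (T x) = hamming_weight x) \<and>
          T ` C = C')"

(* The parameter of vec_space is the dimension of the ambient space: k for rank, which is
   the dimension of the column span, and n for row_space. *)
definition generator_matrix :: "nat \<Rightarrow> nat \<Rightarrow> bit vec set \<Rightarrow> bit mat \<Rightarrow> bool" where
  "generator_matrix n k C G \<longleftrightarrow>
     G \<in> carrier_mat k n \<and> vec_space.rank k G = k \<and> vec_space.row_space n G = C"

definition append_cols :: "bit mat \<Rightarrow> bit mat \<Rightarrow> bit mat" where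
  "append_cols A B =
     four_block_mat A B (0\<^sub>m 0 (dim_col A)) (0\<^sub>m 0 (dim_col B))"

end

theory Submission
  imports Defs
begin

text \<open>
  Identify codewords with their supports. In a minimal code any two nonzero codewords meet, so
  the restriction of the code to the support of a codeword V is injective, and the restriction to
  its complement has kernel 0, V. Hence every weight lies between k and n - (k - 1) = 2(k - 1).
  A codeword V of maximal weight has weight 2(k - 1), so the code restricted to the k - 1
  remaining positions is everything. If A meets these positions in one point, the weights of
  A and A + V add up to 2k, so both are k.

  The support of a codeword c of weight k is thus an information set. A codeword r meeting it in
  a single point has weight at least k, and wt (c + r) = wt r + k - 2 is at most 2(k - 1), so r
  has weight k. These r are the rows of G; they sum to c, which vanishes on the columns of P.
\<close>

section \<open>Binary linear codes as families of supports, with symmetric difference as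
  addition\<close>

locale xor_family =
  fixes F :: "'a set set" and Z :: "'a set"
  assumes finite_ground: "finite Z"
    and members: "A \<in> F \<Longrightarrow> A \<subseteq> Z"
    and empty_mem: "{} \<in> F"
    and sym_diff_mem: "A \<in> F \<Longrightarrow> B \<in> F \<Longrightarrow> sym_diff A B \<in> F"
begin

lemma finite_member: "A \<in> F \<Longrightarrow> finite A"
  using finite_ground members finite_subset by blast

lemma finite_family: "finite F"
  using finite_ground members by (meson PowI finite_Pow_iff finite_subset subsetI)

lemma exists_large_member:
  assumes "2 ^ m \<le> card F"
  shows "\<exists>A\<in>F. m \<le> card A"
proof -
  \<comment> \<open>\<open>P J\<close> says that the trace on \<open>J\<close> determines a member;
    \<open>Z\<close> has this property, so some \<open>J\<close> of least size exists.\<close>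
  define P where "P J \<longleftrightarrow> J \<subseteq> Z \<and> (\<forall>A\<in>F. A \<inter> J = {} \<longrightarrow> A = {})" for J
  have "P Z"
    using members unfolding P_def by blast
  then obtain J where J: "P J" and J_min: "\<And>J'. P J' \<Longrightarrow> card J \<le> card J'"
    using ex_has_least_nat[of P Z card] by blast
  \<comment> \<open>By minimality J is independent, so F realises every subset of J, in particular J itself.\<close>
  have finJ: "finite J"
    using J finite_ground finite_subset unfolding P_def by blast
  have single: "\<exists>A\<in>F. A \<inter> J = {j}" if "j \<in> J" for j
  proof -
    \<comment> \<open>Dropping \<open>j\<close> destroys \<open>P\<close>, so a nonempty member
      misses \<open>J - {j}\<close>; it still meets \<open>J\<close>, hence exactly in
      \<open>j\<close>.\<close>
    have "\<not> P (J - {j})"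
      using J_min[of "J - {j}"] that finJ by (metis card_Diff1_less linorder_not_less)
    then obtain A where "A \<in> F" "A \<inter> (J - {j}) = {}" "A \<noteq> {}"
      using J unfolding P_def by blast
    moreover from this have "A \<inter> J \<noteq> {}"
      using J unfolding P_def by blast
    ultimately show ?thesis by blast
  qed
  have trace: "\<exists>A\<in>F. A \<inter> J = T" if "finite T" "T \<subseteq> J" for T
    using that
  proof (induction T rule: finite_induct)
    case empty
    then show ?case using empty_mem by blast
  next
    case (insert j T)
    then obtain A B where "A \<in> F" "A \<inter> J = T" "B \<in> F" "B \<inter> J = {j}"
      using single by blast
    moreover have "sym_diff A B \<inter> J = sym_diff (A \<inter> J) (B \<inter> J)"
      by blast
    ultimately have "sym_diff A B \<inter> J = insert j T" "sym_diff A B \<in> F"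
      using insert.hyps sym_diff_mem by auto
    then show ?case by (rule bexI)
  qed
  obtain A where A: "A \<in> F" "A \<inter> J = J"
    using trace[OF finJ] by blast
  have "inj_on (\<lambda>A. A \<inter> J) F"
  proof (rule inj_onI)
    fix A B assume AB: "A \<in> F" "B \<in> F" "A \<inter> J = B \<inter> J"
    then have "sym_diff A B \<inter> J = {}" by blast
    then have "sym_diff A B = {}"
      using J sym_diff_mem[OF AB(1,2)] unfolding P_def by blast
    then show "A = B" by blast
  qed
  then have "card F \<le> card (Pow J)"
    using finJ by (intro card_inj_on_le) auto
  then have "(2::nat) ^ m \<le> 2 ^ card J"
    using assms unfolding card_Pow[OF finJ] by linarith
  then have "m \<le> card J" by simp
  also have "card J \<le> card A"
    using A finite_member by (metis card_mono inf_le1)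
  finally show ?thesis using A by blast
qed

text \<open>Puncturing at \<open>V\<close>: this makes \<open>exists_large_member\<close> applicable
  to the parts of members outside \<open>V\<close>.\<close>

lemma xor_family_residual: "xor_family ((\<lambda>A. A - V) ` F) (Z - V)"
proof
  show "finite (Z - V)" using finite_ground by blast
  show "A \<subseteq> Z - V" if "A \<in> (\<lambda>A. A - V) ` F" for A
    using that members by blast
  show "{} \<in> (\<lambda>A. A - V) ` F"
    using empty_mem by force
  show "sym_diff A B \<in> (\<lambda>A. A - V) ` F"
    if AB: "A \<in> (\<lambda>A. A - V) ` F" "B \<in> (\<lambda>A. A - V) ` F" for A B
  proof -
    obtain A' B' where "A' \<in> F" "B' \<in> F" "A = A' - V" "B = B' - V"
      using AB by blast
    moreover from this have "sym_diff A B = sym_diff A' B' - V" by blast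
    ultimately show ?thesis using sym_diff_mem by blast
  qed
qed

end

section \<open>Minimal codes: no nonempty support lies strictly inside another\<close>

locale minimal_xor_family = xor_family +
  assumes not_psubset: "A \<in> F \<Longrightarrow> B \<in> F \<Longrightarrow> A \<noteq> {} \<Longrightarrow> \<not> A \<subset> B"
begin

text \<open>Disjoint nonempty members would lie strictly inside their sum, against its
  minimality.\<close>

lemma members_meet:
  assumes "A \<in> F" "B \<in> F" "A \<noteq> {}" "B \<noteq> {}"
  shows "A \<inter> B \<noteq> {}"
proof
  assume "A \<inter> B = {}"
  then have "A \<subset> sym_diff A B" using assms by blast
  then show False
    using not_psubset[OF assms(1) sym_diff_mem[OF assms(1,2)]] assms(3) by blast
qed

lemma inj_on_trace:
  assumes "V \<in> F" "V \<noteq> {}"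
  shows "inj_on (\<lambda>A. A \<inter> V) F"
proof (rule inj_onI)
  fix A B assume AB: "A \<in> F" "B \<in> F" "A \<inter> V = B \<inter> V"
  then have "sym_diff A B \<inter> V = {}" by blast
  then have "sym_diff A B = {}"
    using members_meet[OF sym_diff_mem[OF AB(1,2)]] assms by blast
  then show "A = B" by blast
qed

text \<open>Removing \<open>V\<close> identifies \<open>A\<close> only with
  \<open>sym_diff A V\<close>; a fixed point \<open>z\<close> of \<open>V\<close> tells these two
  apart.\<close>

lemma card_family_le_residual:
  assumes "V \<in> F" "V \<noteq> {}"
  shows "card F \<le> 2 * card ((\<lambda>A. A - V) ` F)"
proof -
  obtain z where z: "z \<in> V" using assms by blast
  have "inj_on (\<lambda>A. (A - V, z \<in> A)) F"
  proof (rule inj_onI)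
    fix A B assume AB: "A \<in> F" "B \<in> F" "(A - V, z \<in> A) = (B - V, z \<in> B)"
    then have "sym_diff A B \<subset> V" using z by blast
    then have "sym_diff A B = {}"
      using not_psubset[OF sym_diff_mem[OF AB(1,2)] assms(1)] by blast
    then show "A = B" by blast
  qed
  then have "card F \<le> card ((\<lambda>A. A - V) ` F \<times> (UNIV :: bool set))"
    using finite_family by (intro card_inj_on_le) auto
  then show ?thesis by (simp add: card_cartesian_product)
qed

section \<open>Weights in a minimal code of dimension k\<close>

context
  fixes k :: nat
  assumes card_family: "card F = 2 ^ k"
begin

text \<open>The \<open>2 ^ k\<close> members leave distinct traces on \<open>V\<close>, so
  \<open>V\<close> has at least that many subsets.\<close>

lemma card_member_ge:
  assumes "V \<in> F" "V \<noteq> {}"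
  shows "k \<le> card V"
proof -
  have "card F \<le> card (Pow V)"
    using inj_on_trace[OF assms] finite_member[OF assms(1)]
    by (intro card_inj_on_le[where f = "\<lambda>A. A \<inter> V"]) auto
  then show ?thesis
    using card_family by (simp add: card_Pow[OF finite_member[OF assms(1)]])
qed

lemma card_residual_ge:
  assumes "V \<in> F" "V \<noteq> {}" "k > 0"
  shows "2 ^ (k - 1) \<le> card ((\<lambda>A. A - V) ` F)"
  using card_family_le_residual[OF assms(1,2)] card_family power_Suc[of "2::nat" "k - 1"] assms(3)
  by simp

text \<open>There are at least \<open>2 ^ (k - 1)\<close> residuals, all subsets of
  \<open>Z - V\<close>, which therefore has at least \<open>k - 1\<close> points.\<close>

lemma card_member_le:
  assumes "V \<in> F" "V \<noteq> {}" "k > 0"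
  shows "card V + (k - 1) \<le> card Z"
proof -
  have fin: "finite (Z - V)" using finite_ground by blast
  have "card ((\<lambda>A. A - V) ` F) \<le> card (Pow (Z - V))"
    using members fin by (intro card_mono) auto
  then have "(2::nat) ^ (k - 1) \<le> 2 ^ card (Z - V)"
    using card_residual_ge[OF assms] unfolding card_Pow[OF fin] by linarith
  then have "k - 1 \<le> card (Z - V)" by simp
  moreover have "card (Z - V) = card Z - card V" "card V \<le> card Z"
    using members[OF assms(1)] finite_ground
    by (auto simp: card_Diff_subset card_mono finite_subset)
  ultimately show ?thesis by linarith
qed

text \<open>\<open>A\<close> and \<open>sym_diff A V\<close> agree outside \<open>V\<close>, and
  each point of \<open>V\<close> lies in exactly one of them.\<close>

lemma card_add_card_sym_diff:
  assumes "A \<in> F" "V \<in> F"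
  shows "card A + card (sym_diff A V) = 2 * card (A - V) + card V"
proof -
  have fin: "finite A" "finite V" using assms finite_member by auto
  have "card A = card (A - V) + card (A \<inter> V)" "card V = card (V - A) + card (A \<inter> V)"
    using fin by (metis card_Diff_subset_Int card_Int_Diff add.commute inf.commute)+
  moreover have "card (sym_diff A V) = card (A - V) + card (V - A)"
    using fin by (intro card_Un_disjoint) auto
  ultimately show ?thesis by linarith
qed

text \<open>If the largest member V were smaller than claimed, take A as large as possible outside V:
  A and its symmetric difference with V have the same part outside V and complementary traces
  on V, so one of them would be larger than V.\<close>

lemma exists_member_card_ge:
  assumes "k > 0"
  shows "\<exists>V\<in>F. V \<noteq> {} \<and> 2 * (k - 1) \<le> card V"
proof -
  have "F \<noteq> {{}}" using card_family one_less_power[OF _ assms, of "2::nat"] by auto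
  then obtain V0 where "V0 \<in> F - {{}}" using empty_mem by blast
  moreover have "card A \<le> card Z" if "A \<in> F" for A
    using members[OF that] finite_ground by (rule card_mono[rotated])
  ultimately have "\<exists>V. V \<in> F - {{}} \<and> (\<forall>A. A \<in> F - {{}} \<longrightarrow> card A \<le> card V)"
    by (intro ex_has_greatest_nat[where b = "Suc (card Z)"]) (auto simp: less_Suc_eq_le)
  then obtain V where V: "V \<in> F - {{}}"
    and max: "\<And>A. A \<in> F - {{}} \<Longrightarrow> card A \<le> card V"
    by blast
  interpret residual: xor_family "(\<lambda>A. A - V) ` F" "Z - V"
    by (rule xor_family_residual)
  obtain A where A: "A \<in> F" "k - 1 \<le> card (A - V)"
    using residual.exists_large_member[of "k - 1"] card_residual_ge assms V by blast
  \<comment> \<open>\<open>max\<close> covers nonempty members only, and \<open>sym_diff A V\<close>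
    may be empty.\<close>
  have "card B \<le> card V" if "B \<in> F" for B
    using max[of B] that by (cases "B = {}") auto
  then have "card A \<le> card V" "card (sym_diff A V) \<le> card V"
    using A(1) V sym_diff_mem by auto
  then have "2 * (k - 1) \<le> card V"
    using card_add_card_sym_diff[of A V] A V by force
  then show ?thesis using V by blast
qed

lemma exists_member_card_eq:
  assumes "k > 1" "card Z = 3 * (k - 1)"
  shows "\<exists>A\<in>F. card A = k"
proof -
  have k0: "k > 0" using assms by simp
  obtain V where V: "V \<in> F" "V \<noteq> {}" "2 * (k - 1) \<le> card V"
    using exists_member_card_ge[OF k0] by blast
  have cV: "card V = 2 * (k - 1)"
    using card_member_le[OF V(1,2) k0] V(3) assms(2) by linarith
  have fin: "finite (Z - V)" using finite_ground by blast
  have cZV: "card (Z - V) = k - 1"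
    using cV members[OF V(1)] finite_ground assms(2)
    by (simp add: card_Diff_subset finite_subset)
  \<comment> \<open>\<open>Z - V\<close> has \<open>2 ^ (k - 1)\<close> subsets and there are at
    least as many residuals, so every subset occurs.\<close>
  have "(\<lambda>A. A - V) ` F \<subseteq> Pow (Z - V)"
    using members by blast
  moreover have "card (Pow (Z - V)) \<le> card ((\<lambda>A. A - V) ` F)"
    using card_residual_ge[OF V(1,2) k0] by (simp add: card_Pow[OF fin] cZV)
  ultimately have all: "(\<lambda>A. A - V) ` F = Pow (Z - V)"
    using fin by (intro card_seteq) auto
  have "Z - V \<noteq> {}"
    using cZV assms(1) by (intro notI) simp
  then obtain j where "j \<in> Z - V" by blast
  then have "{j} \<in> (\<lambda>A. A - V) ` F"
    unfolding all by blast
  then obtain A where A: "A \<in> F" "A - V = {j}"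
    by (metis (no_types, lifting) imageE)
  \<comment> \<open>Both sets contain \<open>j\<close>, hence are nonempty; their sizes add up to
    \<open>2 + 2 * (k - 1) = 2 * k\<close>, so both bounds are attained.\<close>
  have "k \<le> card A" "k \<le> card (sym_diff A V)"
    using A V sym_diff_mem card_member_ge by blast+
  then have "card A = k"
    using card_add_card_sym_diff[OF A(1) V(1)] A(2) cV k0 by simp
  then show ?thesis using A(1) by blast
qed

text \<open>Taking traces is injective from \<open>2 ^ k\<close> members to the \<open>2 ^ k\<close>
  subsets of \<open>V\<close>, hence onto.\<close>

lemma exists_member_trace_eq:
  assumes "V \<in> F" "V \<noteq> {}" "card V = k" "T \<subseteq> V"
  shows "\<exists>A\<in>F. A \<inter> V = T"
proof -
  have fin: "finite (Pow V)" using finite_member[OF assms(1)] by simp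
  have "card ((\<lambda>A. A \<inter> V) ` F) = card (Pow V)"
    using card_image[OF inj_on_trace[OF assms(1,2)]] card_family assms(3)
    by (simp add: card_Pow[OF finite_member[OF assms(1)]])
  then have "(\<lambda>A. A \<inter> V) ` F = Pow V"
    using fin by (intro card_subset_eq) auto
  then show ?thesis using assms(4) by (metis (no_types, lifting) PowI imageE)
qed

lemma card_eq_if_trace_singleton:
  assumes "k > 1" "card Z = 3 * (k - 1)"
    and "V \<in> F" "card V = k" "A \<in> F" "A \<inter> V = {j}"
  shows "card A = k"
proof -
  \<comment> \<open>Otherwise \<open>A = V\<close>, whose trace on itself has \<open>k > 1\<close>
    points.\<close>
  have "sym_diff A V \<noteq> {}"
    using assms(1,4,6) by (cases "A = V") auto
  then have "card (sym_diff A V) \<le> 2 * (k - 1)"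
    using card_member_le[OF sym_diff_mem[OF assms(5,3)]] assms(1,2) by linarith
  moreover have "card A = card (A - V) + 1"
    using card_Int_Diff[OF finite_member[OF assms(5)], of V] assms(6) by simp
  moreover have "k \<le> card A"
    using card_member_ge assms(5,6) by blast
  ultimately show ?thesis
    using card_add_card_sym_diff[OF assms(5,3)] assms(1,4) by linarith
qed

end

end

text \<open>Keeps bit arithmetic in ring form, so that facts about sums and products apply.\<close>

declare add_bit_eq_xor [simp del] mult_bit_eq_and [simp del]

section \<open>Binary vectors, their supports and the size of a code\<close>

lemma add_bit_eq_0_iff: "a + b = 0 \<longleftrightarrow> a = b" for a b :: bit
  by (cases a; cases b) simp_all

lemma support_subset: "x \<in> carrier_vec n \<Longrightarrow> support x \<subseteq> {..<n}"
  by (auto simp: support_def)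

lemma support_add:
  assumes "x \<in> carrier_vec n" "y \<in> carrier_vec n"
  shows "support (x + y) = sym_diff (support x) (support y)"
proof -
  have "a + b \<noteq> 0 \<longleftrightarrow> (a \<noteq> 0 \<and> b = 0 \<or> b \<noteq> 0 \<and> a = 0)" for a b :: bit
    by (cases a; cases b) simp_all
  then show ?thesis
    using assms by (auto simp: support_def)
qed

text \<open>Over F_2 an entry is determined by whether it vanishes.\<close>

lemma inj_on_support: "inj_on support (carrier_vec n)"
proof (rule inj_onI)
  fix x y assume xy: "x \<in> carrier_vec n" "y \<in> carrier_vec n" "support x = support y"
  show "x = y"
  proof (rule eq_vecI)
    fix i assume "i < dim_vec y"
    then have "x $ i = 0 \<longleftrightarrow> y $ i = 0"
      using xy by (auto simp: support_def set_eq_iff simp del: bit_not_zero_iff)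
    then show "x $ i = y $ i" by (cases "x $ i"; cases "y $ i") simp_all
  qed (use xy in simp)
qed

lemma support_eq_empty_iff: "x \<in> carrier_vec n \<Longrightarrow> support x = {} \<longleftrightarrow> x = 0\<^sub>v n"
  by (auto simp: support_def)

lemma subspace_F2I:
  assumes "C \<subseteq> carrier_vec n" "0\<^sub>v n \<in> C" "\<And>x y. x \<in> C \<Longrightarrow> y \<in> C \<Longrightarrow> x + y \<in> C"
  shows "subspace class_ring C (F2_space n)"
proof -
  have "c \<cdot>\<^sub>v x \<in> C" if "x \<in> C" for c :: bit and x
  proof (cases c)
    case zero
    then have "c \<cdot>\<^sub>v x = 0\<^sub>v n" using that assms(1) by (intro eq_vecI) auto
    then show ?thesis using assms(2) by simp
  next
    case one
    then have "c \<cdot>\<^sub>v x = x" by simp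
    then show ?thesis using that by simp
  qed
  then show ?thesis
    using assms unfolding subspace_def submodule_def
    by (auto simp: vec_vs vec_module module_vec_simps)
qed

lemma subspace_F2D:
  assumes "subspace class_ring C (F2_space n)"
  shows "C \<subseteq> carrier_vec n" "0\<^sub>v n \<in> C" "x \<in> C \<Longrightarrow> y \<in> C \<Longrightarrow> x + y \<in> C"
  using assms unfolding subspace_def submodule_def by (auto simp: module_vec_simps)

lemma finite_subset_carrier_vec_bit: "C \<subseteq> carrier_vec n \<Longrightarrow> finite (C :: bit vec set)"
  by (rule inj_on_finite[OF inj_on_subset[OF inj_on_support], of C n "Pow {..<n}"])
    (use support_subset in auto)

text \<open>Turns dimension into the cardinality used above: coordinates in a basis \<open>B\<close>
  match \<open>C\<close> with the functions from \<open>B\<close> to the two bits.\<close>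

lemma card_subspace_F2:
  assumes "subspace class_ring C (F2_space n)"
  shows "card C = 2 ^ vectorspace.dim class_ring ((F2_space n)\<lparr>carrier := C\<rparr>)"
proof -
  interpret amb: vectorspace "class_ring :: bit ring" "F2_space n"
    by (rule vec_vs)
  interpret C: vectorspace "class_ring :: bit ring" "(F2_space n)\<lparr>carrier := C\<rparr>"
    by (rule amb.subspace_is_vs[OF assms])
  have finC: "finite C"
    using finite_subset_carrier_vec_bit subspace_F2D(1)[OF assms] .
  \<comment> \<open>The finite set \<open>C\<close> generates itself, which gives a finite
    basis.\<close>
  have "C.gen_set C"
    using C.in_own_span[of C] C.span_is_subset2[of C] by auto
  then have "C.fin_dim"
    using finC unfolding C.fin_dim_def by auto
  then obtain B where B: "finite B" "C.basis B"
    using C.finite_basis_exists by blast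
  have BC: "B \<subseteq> C" using B(2) unfolding C.basis_def by simp
  have uniq: "\<exists>!a. a \<in> B \<rightarrow>\<^sub>E UNIV \<and> C.lincomb a B = v" if "v \<in> C" for v
    using C.basis_criterion[OF B(1)] BC B(2) that by simp
  have "bij_betw (\<lambda>a. C.lincomb a B) (B \<rightarrow>\<^sub>E UNIV) C"
  proof (rule bij_betwI')
    fix a b assume "a \<in> B \<rightarrow>\<^sub>E (UNIV :: bit set)" "b \<in> B \<rightarrow>\<^sub>E (UNIV :: bit set)"
    moreover have "C.lincomb a B \<in> C" for a
      using C.lincomb_closed[of B a] BC by simp
    ultimately show "C.lincomb a B = C.lincomb b B \<longleftrightarrow> a = b"
      using uniq by metis
  next
    fix a show "C.lincomb a B \<in> C"
      using C.lincomb_closed[of B a] BC by simp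
  next
    fix v assume "v \<in> C"
    then show "\<exists>a\<in>B \<rightarrow>\<^sub>E UNIV. v = C.lincomb a B"
      using uniq by metis
  qed
  then have "card C = card (B \<rightarrow>\<^sub>E (UNIV :: bit set))"
    by (simp add: bij_betw_same_card)
  also have "(UNIV :: bit set) = {0, 1}"
    using bit.exhaust by blast
  finally show ?thesis
    using C.dim_basis[OF B] B(1) by (simp add: card_PiE numeral_2_eq_2)
qed

lemma minimal_xor_family_supports:
  assumes "subspace class_ring C (F2_space n)" "minimal_code n C"
  shows "minimal_xor_family (support ` C) {..<n}"
proof
  note C = subspace_F2D[OF assms(1)]
  show "A \<subseteq> {..<n}" if "A \<in> support ` C" for A
    using that C(1) support_subset by blast
  show "{} \<in> support ` C"
    using C(1,2) support_eq_empty_iff by (metis image_eqI zero_carrier_vec)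
  show "sym_diff A B \<in> support ` C" if "A \<in> support ` C" "B \<in> support ` C" for A B
    using that C(1,3) support_add by (smt (verit) image_iff subsetD)
  show "\<not> A \<subset> B" if AB: "A \<in> support ` C" "B \<in> support ` C" "A \<noteq> {}" for A B
  proof
    obtain x y where xy: "x \<in> C" "A = support x" "y \<in> C" "B = support y"
      using AB by blast
    assume "A \<subset> B"
    then have "x \<noteq> 0\<^sub>v n" "y \<noteq> 0\<^sub>v n"
      using xy AB C(1) support_eq_empty_iff by blast+
    then show False
      using assms(2) xy \<open>A \<subset> B\<close> unfolding minimal_code_def minimal_codeword_def by blast
  qed
qed simp

section \<open>Coordinate permutations, acting by pulling entries back along
  \<open>\<pi>\<close>\<close>

definition permute_vec :: "nat \<Rightarrow> (nat \<Rightarrow> nat) \<Rightarrow> 'a vec \<Rightarrow> 'a vec" where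
  "permute_vec n \<pi> x = vec n (\<lambda>i. x $ \<pi> i)"

context
  fixes n :: nat and \<pi> :: "nat \<Rightarrow> nat"
  assumes bij: "bij_betw \<pi> {..<n} {..<n}"
begin

lemma perm_less: "i < n \<Longrightarrow> \<pi> i < n"
  using bij bij_betwE by blast

lemma permute_vec_add:
  assumes "x \<in> carrier_vec n" "y \<in> carrier_vec n"
  shows "permute_vec n \<pi> (x + y) = permute_vec n \<pi> x + permute_vec n \<pi> y"
  using assms by (intro eq_vecI) (auto simp: permute_vec_def perm_less)

lemma linear_map_permute_vec:
  "linear_map class_ring (F2_space n) (F2_space n) (permute_vec n \<pi>)"
proof -
  have smult: "permute_vec n \<pi> (c \<cdot>\<^sub>v x) = c \<cdot>\<^sub>v permute_vec n \<pi> x"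
    if "x \<in> carrier_vec n" for c :: bit and x
    using that by (intro eq_vecI) (auto simp: permute_vec_def perm_less)
  have "permute_vec n \<pi> \<in> LinearCombinations.module_hom class_ring (F2_space n) (F2_space n)"
    unfolding LinearCombinations.module_hom_def
    by (simp add: module_vec_simps permute_vec_add smult)
      (simp add: permute_vec_def)
  then show ?thesis
    by (intro linear_map.intro mod_hom.intro mod_hom_axioms.intro vec_vs vec_module)
qed

lemma support_permute_vec:
  assumes "x \<in> carrier_vec n"
  shows "support (permute_vec n \<pi> x) = {i. i < n \<and> \<pi> i \<in> support x}"
  using assms by (auto simp: support_def permute_vec_def perm_less)

lemma hamming_weight_permute_vec:
  assumes "x \<in> carrier_vec n"
  shows "hamming_weight (permute_vec n \<pi> x) = hamming_weight x"
proof -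
  have "\<pi> ` support (permute_vec n \<pi> x) = support x"
    using bij support_subset[OF assms]
    unfolding support_permute_vec[OF assms] bij_betw_def by auto
  moreover have "inj_on \<pi> (support (permute_vec n \<pi> x))"
    using bij unfolding bij_betw_def support_permute_vec[OF assms]
    by (auto intro: inj_on_subset)
  ultimately show ?thesis
    unfolding hamming_weight_def by (metis card_image)
qed

lemma subspace_permute_vec:
  assumes "subspace class_ring C (F2_space n)"
  shows "subspace class_ring (permute_vec n \<pi> ` C) (F2_space n)"
proof (rule subspace_F2I)
  note C = subspace_F2D[OF assms]
  show "permute_vec n \<pi> ` C \<subseteq> carrier_vec n"
    by (auto simp: permute_vec_def)
  have "permute_vec n \<pi> (0\<^sub>v n) = 0\<^sub>v n"
    by (intro eq_vecI) (auto simp: permute_vec_def perm_less)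
  then show "0\<^sub>v n \<in> permute_vec n \<pi> ` C"
    using C(2) by (metis imageI)
  show "x + y \<in> permute_vec n \<pi> ` C"
    if "x \<in> permute_vec n \<pi> ` C" "y \<in> permute_vec n \<pi> ` C" for x y
    using that C(1,3) permute_vec_add by (smt (verit) image_iff subsetD)
qed

end

text \<open>Used to move an information set to the front; enumerations of \<open>V\<close> and of
  its complement are glued.\<close>

lemma exists_bij_betw_initial_segment:
  assumes "V \<subseteq> {..<n}" "card V = k"
  shows "\<exists>\<pi>. bij_betw \<pi> {..<n} {..<n} \<and> \<pi> ` {..<k} = V"
proof -
  have fin: "finite V" using assms finite_subset by blast
  have kn: "k \<le> n" using card_mono[OF _ assms(1)] assms(2) by simp
  obtain f where f: "bij_betw f {..<k} V"
    using finite_same_card_bij[OF _ fin, of "{..<k}"] assms(2) by auto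
  obtain g where g: "bij_betw g {k..<n} ({..<n} - V)"
    using finite_same_card_bij[of "{k..<n}" "{..<n} - V"] assms fin
    by (auto simp: card_Diff_subset)
  define \<pi> where "\<pi> i = (if i \<in> {..<k} then f i else g i)" for i
  have "bij_betw \<pi> ({..<k} \<union> {k..<n}) (V \<union> ({..<n} - V))"
    unfolding \<pi>_def using f g by (intro bij_betw_disjoint_Un) auto
  moreover have "{..<k} \<union> {k..<n} = {..<n}" "V \<union> ({..<n} - V) = {..<n}"
    using kn assms(1) by auto
  moreover have "\<pi> ` {..<k} = V"
    using f unfolding \<pi>_def bij_betw_def by auto
  ultimately show ?thesis by auto
qed

section \<open>Parity of weights and systematic generator matrices\<close>

lemma even_hamming_weight_iff: "even (hamming_weight x) \<longleftrightarrow> (\<Sum>i<dim_vec x. x $ i) = 0"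
proof -
  have "(\<Sum>i<dim_vec x. x $ i) = (\<Sum>i\<in>support x. 1)"
  proof (rule sum.mono_neutral_cong_right)
    show "\<forall>i\<in>{..<dim_vec x} - support x. x $ i = 0" by (auto simp: support_def)
    show "x $ i = 1" if "i \<in> support x" for i
      using that unfolding support_def by (cases "x $ i") auto
  qed (auto simp: support_def)
  also have "\<dots> = of_nat (hamming_weight x)"
    by (simp add: hamming_weight_def)
  also have "of_nat m = (0::bit) \<longleftrightarrow> even m" for m
    by (induction m) (auto simp: add_bit_eq_0_iff)
  finally show ?thesis by simp
qed

text \<open>The identity block gives full rank. A codeword is the combination of rows whose
  coefficients are its own first \<open>k\<close> entries, since both agree there and
  \<open>inj\<close> applies.\<close>

lemma generator_matrix_systematic:
  assumes sub: "subspace class_ring C (F2_space n)" and "k \<le> n"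
    and inj: "\<And>x y. x \<in> C \<Longrightarrow> y \<in> C \<Longrightarrow> (\<And>j. j < k \<Longrightarrow> x $ j = y $ j) \<Longrightarrow> x = y"
    and G: "G \<in> carrier_mat k n" "\<And>i. i < k \<Longrightarrow> row G i \<in> C"
    and unit: "\<And>i j. i < k \<Longrightarrow> j < k \<Longrightarrow> G $$ (i, j) = (if i = j then 1 else 0)"
  shows "generator_matrix n k C G"
proof -
  interpret K: vec_space "TYPE(bit)" k .
  interpret N: vec_space "TYPE(bit)" n .
  have "y \<in> K.col_space G" if y: "y \<in> carrier_vec k" for y
  proof -
    \<comment> \<open>Padding \<open>y\<close> with zeros lets the identity block reproduce
      it.\<close>
    let ?x = "vec n (\<lambda>j. if j < k then y $ j else 0)"
    have "G *\<^sub>v ?x = y"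
    proof (rule eq_vecI)
      fix i assume "i < dim_vec y"
      then have i: "i < k" using y by simp
      have "(G *\<^sub>v ?x) $ i = (\<Sum>j<n. G $$ (i, j) * ?x $ j)"
        using i G(1) by (auto simp: scalar_prod_def lessThan_atLeast0 intro!: sum.cong)
      also have "\<dots> = (\<Sum>j\<in>{i}. y $ j)"
        using i \<open>k \<le> n\<close> unit by (intro sum.mono_neutral_cong_right) auto
      finally show "(G *\<^sub>v ?x) $ i = y $ i" by simp
    qed (use G(1) y in simp)
    then show ?thesis
      unfolding K.col_space_eq[OF G(1)] using G(1) y by fastforce
  qed
  moreover have "K.col_space G \<subseteq> carrier_vec k"
    unfolding K.col_space_eq[OF G(1)] using G(1) by auto
  ultimately have "K.span (set (cols G)) = carrier_vec k"
    unfolding K.col_space_def by blast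
  then have rank: "K.rank G = k"
    unfolding K.rank_def using K.dim_is_n by (simp add: module_vec_def)
  have "set (rows G) \<subseteq> C"
    using G by (auto simp: set_conv_nth)
  then have sub_row: "N.row_space G \<subseteq> C"
    unfolding N.row_space_def using sub N.span_is_subset by (simp add: subspace_def)
  have "x \<in> N.row_space G" if x: "x \<in> C" for x
  proof -
    let ?y = "vec k (\<lambda>i. x $ i)"
    let ?w = "G\<^sup>T *\<^sub>v ?y"
    have w: "?w \<in> N.row_space G"
      unfolding N.row_space_eq[OF G(1)] using G(1) by fastforce
    have "?w $ j = x $ j" if j: "j < k" for j
    proof -
      have "?w $ j = (\<Sum>i<k. G $$ (i, j) * x $ i)"
        using j \<open>k \<le> n\<close> G(1) by (auto simp: scalar_prod_def lessThan_atLeast0 intro!: sum.cong)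
      also have "\<dots> = (\<Sum>i\<in>{j}. x $ i)"
        using j unit by (intro sum.mono_neutral_cong_right) auto
      finally show ?thesis by simp
    qed
    then have "?w = x" using inj[of ?w x] w sub_row x by blast
    then show ?thesis using w by simp
  qed
  then show ?thesis
    using sub_row rank G(1) unfolding generator_matrix_def by blast
qed

text \<open>The length is equated over the integers, so truncated subtraction cannot turn
  \<open>k = 0\<close> into \<open>n = 0\<close>.\<close>

theorem proposition4p1:
  fixes n k d :: nat and C :: "bit vec set"
  assumes "binary_code n k d C"
    and "minimal_code n C"
    and "int n = 3 * (int k - 1)"
  shows "(\<exists>C' G P.
            equivalent_codes n C C' \<and>
            generator_matrix n k C' G \<and>
            P \<in> carrier_mat k (2 * k - 3) \<and>
            G = append_cols (1\<^sub>m k) P \<and>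
            (\<forall>i<k. row G i \<in> C' \<and> hamming_weight (row G i) = k) \<and>
            (\<forall>j<2 * k - 3. even (hamming_weight (col P j))))
         \<and> d = k"
proof -
  have sub: "subspace class_ring C (F2_space n)" and card_C: "card C = 2 ^ k"
    and dist: "has_min_distance n C d"
    using assms(1) card_subspace_F2[of C n] unfolding binary_code_def by auto
  note C = subspace_F2D[OF sub]
  interpret minimal_xor_family "support ` C" "{..<n}"
    by (rule minimal_xor_family_supports[OF sub assms(2)])
  have card_F: "card (support ` C) = 2 ^ k"
    using card_C card_image[OF inj_on_subset[OF inj_on_support C(1)]] by simp
  obtain c0 where c0: "c0 \<in> C" "c0 \<noteq> 0\<^sub>v n"
    using dist unfolding has_min_distance_def by blast
  \<comment> \<open>A minimal distance presupposes a nonzero word, which length 0 excludes; a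
    positive length then forces \<open>k > 1\<close>.\<close>
  have "n \<noteq> 0"
  proof
    assume "n = 0"
    then have "dim_vec c0 = 0" using c0(1) C(1) by (metis carrier_vecD subsetD)
    then have "c0 = 0\<^sub>v n" using \<open>n = 0\<close> by simp
    then show False using c0(2) by contradiction
  qed
  then have k1: "k > 1"
    using assms(3) by presburger
  then have n_eq: "n = 3 * (k - 1)"
    using assms(3) by presburger
  obtain c where c: "c \<in> C" "hamming_weight c = k"
    using exists_member_card_eq[OF card_F k1] n_eq unfolding hamming_weight_def by auto
  have c_nz: "c \<noteq> 0\<^sub>v n"
    using c k1 C(1) support_eq_empty_iff[of c n] unfolding hamming_weight_def by fastforce
  have wt_ge: "k \<le> hamming_weight x" if "x \<in> C" "x \<noteq> 0\<^sub>v n" for x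
    using card_member_ge[OF card_F, of "support x"] that C(1) support_eq_empty_iff[of x n]
    unfolding hamming_weight_def by auto
  have d: "d = k"
    using dist wt_ge c c_nz unfolding has_min_distance_def by (metis le_antisym)
  define V where "V = support c"
  have V: "V \<in> support ` C" "V \<noteq> {}" "card V = k"
    using c k1 unfolding V_def hamming_weight_def by auto
  obtain \<pi> where bij: "bij_betw \<pi> {..<n} {..<n}" and \<pi>V: "\<pi> ` {..<k} = V"
    using exists_bij_betw_initial_segment[of V n k] members[OF V(1)] V(3) by blast
  have kn: "n = k + (2 * k - 3)" using n_eq k1 by linarith
  \<comment> \<open>After permuting, this word becomes row \<open>i\<close>: among the first
    \<open>k\<close> positions it is nonzero at \<open>i\<close> only.\<close>
  have "\<exists>x\<in>C. support x \<inter> V = {\<pi> i}" if "i < k" for i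
    using exists_member_trace_eq[OF card_F V, of "{\<pi> i}"] \<pi>V that by blast
  then obtain s where s: "\<And>i. i < k \<Longrightarrow> s i \<in> C" "\<And>i. i < k \<Longrightarrow> support (s i) \<inter> V = {\<pi> i}"
    by metis
  have s_wt: "hamming_weight (s i) = k" if "i < k" for i
    using card_eq_if_trace_singleton[OF card_F k1 _ V(1,3) imageI[OF s(1)[OF that]] s(2)[OF that]]
      n_eq unfolding hamming_weight_def by simp
  define T :: "bit vec \<Rightarrow> bit vec" where "T = permute_vec n \<pi>"
  have T_nth: "T x $ j = x $ \<pi> j" if "j < n" for x j
    using that unfolding T_def permute_vec_def by simp
  have T_carrier: "T x \<in> carrier_vec n" for x
    unfolding T_def permute_vec_def by simp
  have T_wt: "hamming_weight (T x) = hamming_weight x" if "x \<in> carrier_vec n" for x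
    using hamming_weight_permute_vec[OF bij that] unfolding T_def .
  have equiv: "equivalent_codes n C (T ` C)"
    using linear_map_permute_vec[OF bij] T_wt
    unfolding equivalent_codes_def T_def by blast
  have sub': "subspace class_ring (T ` C) (F2_space n)"
    unfolding T_def by (rule subspace_permute_vec[OF bij sub])
  \<comment> \<open>The first \<open>k\<close> positions of permuted words are those of
    \<open>V\<close>, and the trace on \<open>V\<close> determines a codeword.\<close>
  have inj: "x' = y'" if img: "x' \<in> T ` C" "y' \<in> T ` C" and eq: "\<And>j. j < k \<Longrightarrow> x' $ j = y' $ j" for x' y'
  proof -
    obtain x y where xy: "x \<in> C" "y \<in> C" "x' = T x" "y' = T y" using img by blast
    have "x $ v = y $ v" if "v \<in> V" for v
      using that eq \<pi>V xy T_nth kn by force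
    moreover have "dim_vec x = dim_vec y" using xy C(1) by (metis carrier_vecD subsetD)
    ultimately have "support x \<inter> V = support y \<inter> V"
      by (auto simp: support_def)
    then have "support x = support y"
      using inj_on_trace[OF V(1,2)] xy by (auto dest: inj_onD)
    then have "x = y"
      using inj_on_support[of n] C(1) xy by (auto dest: inj_onD)
    then show ?thesis using xy by simp
  qed
  define G where "G = mat k n (\<lambda>(i, j). T (s i) $ j)"
  define P where "P = mat k (2 * k - 3) (\<lambda>(i, j). T (s i) $ (k + j))"
  have G_carrier: "G \<in> carrier_mat k n" unfolding G_def by simp
  have row_G: "row G i = T (s i)" if "i < k" for i
    using that T_carrier[of "s i"] unfolding G_def by (intro eq_vecI) auto
  have unit: "G $$ (i, j) = (if i = j then 1 else 0)" if "i < k" "j < k" for i j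
  proof -
    have "G $$ (i, j) = s i $ \<pi> j"
      using that kn T_nth unfolding G_def by simp
    moreover have "\<pi> j \<in> V" "\<pi> j < n"
      using \<pi>V that members[OF V(1)] by auto
    moreover have "\<pi> i = \<pi> j \<longleftrightarrow> i = j"
      using bij that kn unfolding bij_betw_def inj_on_def by auto
    moreover have "dim_vec (s i) = n"
      using s(1)[OF that(1)] C(1) by (metis carrier_vecD subsetD)
    moreover have "\<pi> j \<in> support (s i) \<inter> V \<longleftrightarrow> \<pi> j = \<pi> i"
      using s(2)[OF that(1)] by simp
    ultimately have "G $$ (i, j) \<noteq> 0 \<longleftrightarrow> i = j"
      unfolding support_def by force
    then show ?thesis by (cases "G $$ (i, j)") auto
  qed
  have gen: "generator_matrix n k (T ` C) G"
    using kn row_G s(1) unit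
    by (intro generator_matrix_systematic[OF sub' _ inj G_carrier]) auto
  have G_append: "G = append_cols (1\<^sub>m k) P"
  proof (rule eq_matI)
    fix i j assume "i < dim_row (append_cols (1\<^sub>m k) P)" "j < dim_col (append_cols (1\<^sub>m k) P)"
    then have "i < k" "j < n"
      using kn by (auto simp: append_cols_def P_def)
    then show "G $$ (i, j) = append_cols (1\<^sub>m k) P $$ (i, j)"
      using unit[of i j] kn by (auto simp: append_cols_def P_def G_def)
  qed (use kn in \<open>auto simp: append_cols_def P_def G_def\<close>)
  have rows: "row G i \<in> T ` C \<and> hamming_weight (row G i) = k" if "i < k" for i
    using row_G[OF that] s(1)[OF that] s_wt[OF that] T_wt C(1) by auto
  have even: "even (hamming_weight (col P j))" if j: "j < 2 * k - 3" for j
  proof -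
    interpret N: vec_space "TYPE(bit)" n .
    \<comment> \<open>\<open>w\<close> is the sum of all rows. It equals \<open>T c\<close>, as both
      are 1 on the first \<open>k\<close> positions; beyond them \<open>T c\<close> vanishes, so the
      columns of \<open>P\<close> sum to 0.\<close>
    define w where "w = G\<^sup>T *\<^sub>v vec k (\<lambda>_. 1)"
    have w_nth: "w $ j = (\<Sum>i<k. G $$ (i, j))" if "j < n" for j
      using that unfolding w_def G_def
      by (auto simp: scalar_prod_def lessThan_atLeast0 intro!: sum.cong)
    have "w \<in> N.row_space G"
      unfolding w_def N.row_space_eq[OF G_carrier] using G_carrier by fastforce
    then have "w \<in> T ` C"
      using gen unfolding generator_matrix_def by simp
    moreover have "w $ i = T c $ i" if "i < k" for i
    proof -
      have "w $ i = (\<Sum>l<k. if l = i then 1 else 0)"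
        using that kn unit w_nth by (auto intro!: sum.cong)
      also have "\<dots> = 1" using that by simp
      finally have "w $ i = 1" .
      moreover have "\<pi> i \<in> support c"
        using \<pi>V that unfolding V_def by blast
      then have "c $ \<pi> i = 1"
        unfolding support_def by (cases "c $ \<pi> i") auto
      ultimately show ?thesis using T_nth that kn by simp
    qed
    ultimately have "w = T c"
      using inj[of w "T c"] c(1) by blast
    \<comment> \<open>\<open>\<pi>\<close> already maps the first \<open>k\<close> positions onto
      \<open>V\<close>, so by injectivity later ones land outside \<open>V\<close>.\<close>
    moreover have "k + j < n" "\<pi> (k + j) \<notin> V"
    proof -
      show kj: "k + j < n" using j kn by simp
      show "\<pi> (k + j) \<notin> V"
      proof
        assume "\<pi> (k + j) \<in> V"
        then obtain i where "i < k" "\<pi> (k + j) = \<pi> i" using \<pi>V by auto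
        then show False
          using bij kj unfolding bij_betw_def inj_on_def by force
      qed
    qed
    moreover have "\<pi> (k + j) < dim_vec c"
      using bij_betwE[OF bij] \<open>k + j < n\<close> c(1) C(1)
      by (metis carrier_vecD lessThan_iff subsetD)
    ultimately have "w $ (k + j) = 0"
      using T_nth unfolding V_def support_def by auto
    then have "(\<Sum>i<k. G $$ (i, k + j)) = 0"
      using w_nth \<open>k + j < n\<close> by simp
    moreover have "(\<Sum>i<dim_vec (col P j). col P j $ i) = (\<Sum>i<k. G $$ (i, k + j))"
      using j \<open>k + j < n\<close> unfolding P_def G_def by (intro sum.cong) auto
    ultimately show ?thesis
      unfolding even_hamming_weight_iff by simp
  qed
  have "P \<in> carrier_mat k (2 * k - 3)" unfolding P_def by simp
  then show ?thesis
    using equiv gen G_append rows even d by blast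
qed

end
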